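(* Let $n\ge 2$, let $\nu=(\nu_1,\dots,\nu_n)\in\mathbb{C}^n$ be regular, and put $\tilde\nu=(\nu_1,\dots,\nu_{n-1})$. Then $c_{1,m_1}(\nu_1)=\dfrac{1}{m_1!\,(2\nu_1+1)_{m_1}}$ for all $m_1\ge 0$ (whenever these are defined), and for every $\mathbf m=(m_1,\dots,m_n)\in\mathbb{Z}_{\ge 0}^n$, \[ c_{n,(m_1,\dots,m_n)}(\nu)=\sum_{\{l_i\},\{k_i\}}\frac{c_{n-1,(k_1,\dots,k_{n-1})}(\tilde\nu)}{\prod_{i=1}^{n-1}(m_i-l_i)!\cdot(m_n-k_{n-1})!\,\prod_{i=1}^{n-1}(l_i-k_i)!}\cdot\frac{1}{\prod_{i=1}^{n}(\nu_i+\nu_n+1)_{m_i-l_{i-1}}\ \prod_{i=1}^{n-1}(\nu_i-\nu_n+1)_{l_i-k_{i-1}}}, \] where the sum runs over all nonnegative integers $l_1,\dots,l_{n-1},k_1,\dots,k_{n-1}$ with $0\le k_i\le l_i\le m_i$ for $1\le i\le n-1$ and $0\le k_{n-1}\le m_n$, and where $k_0=l_0=0$.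
   Context: Pochhammer symbol: $(a)_k=\Gamma(a+k)/\Gamma(a)$ for $k\in\mathbb{Z}$. For $n\ge1$, $\mathbf m=(m_1,\dots,m_n)\in\mathbb{Z}_{\ge0}^n$ and $\nu\in\mathbb{C}^n$ put \[q_n(\mathbf m,\nu)=\sum_{i=1}^{n-1}m_i^2+\tfrac12 m_n^2-\sum_{i=1}^{n-1}m_im_{i+1}+\sum_{i=1}^{n-1}(\nu_i-\nu_{i+1})m_i+\nu_nm_n .\] The numbers $c_{n,\mathbf m}(\nu)$ are defined by $c_{n,(0,\dots,0)}(\nu)=1$, $c_{n,\mathbf m}(\nu)=0$ if some entry of $\mathbf m$ is negative, and the recurrence \[q_n(\mathbf m,\nu)\,c_{n,\mathbf m}(\nu)=\sum_{i=1}^{n-1}c_{n,\mathbf m-\mathbf e_i}(\nu)+\tfrac12 c_{n,\mathbf m-\mathbf e_n}(\nu),\] ($\mathbf e_i$ the $i$-th standard basis vector); they are uniquely determined when $q_n(\mathbf m,\nu)\neq0$ for all $\mathbf m\neq0$. The Weyl group $\mathcal W_n$ is the group of signed permutations of the coordinates of $\mathbb{C}^n$ (generated by the transpositions of $\nu_i,\nu_{i+1}$, $1\le i\le n-1$, and the sign change $\nu_n\mapsto-\nu_n$). An element $\nu\in\mathbb{C}^n$ is called regular if (1) $q_n(\mathbf m,w\nu)\neq0$ for all $\mathbf m\in\mathbb{Z}_{\ge0}^n\setminus\{0\}$ and all $w\in\mathcal W_n$, and (2) for all $w\neq w'$ in $\mathcal W_n$, $w\nu-w'\nu$ is not an integer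 linear combination of the vectors $\alpha_i=\tfrac12(\varepsilon_i-\varepsilon_{i+1})$ ($1\le i\le n-1$) and $\alpha_n=\tfrac12\varepsilon_n$, where $\varepsilon_i$ is the standard basis of $\mathbb{C}^n$. *)

theory Defs
  imports "HOL-Analysis.Analysis" "HOL-Combinatorics.Permutations"
begin

text \<open>
  Vectors of length \<open>n\<close> are functions on \<^typ>\<open>nat\<close> of which only the entries with index in
  \<open>{1..n}\<close> matter, so that \<open>n\<close> can vary; see \<open>ccoef_cong\<close>.
\<close>

text \<open>The Pochhammer symbol for an integer, possibly negative, index; the library's
  \<^const>\<open>pochhammer\<close> only covers natural indices.\<close>

definition poch :: "complex \<Rightarrow> int \<Rightarrow> complex" where
  "poch a k = Gamma (a + of_int k) / Gamma a"

definition qform :: "nat \<Rightarrow> (nat \<Rightarrow> int) \<Rightarrow> (nat \<Rightarrow> complex) \<Rightarrow> complex" where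
  "qform n m \<nu> =
     (\<Sum>i=1..n-1. of_int (m i) ^ 2) + 1/2 * of_int (m n) ^ 2
     - (\<Sum>i=1..n-1. of_int (m i) * of_int (m (i+1)))
     + (\<Sum>i=1..n-1. (\<nu> i - \<nu> (i+1)) * of_int (m i)) + \<nu> n * of_int (m n)"

definition nondegenerate :: "nat \<Rightarrow> (nat \<Rightarrow> complex) \<Rightarrow> bool" where
  "nondegenerate n \<nu> \<longleftrightarrow>
     (\<forall>m :: nat \<Rightarrow> nat. (\<exists>i\<in>{1..n}. m i \<noteq> 0) \<longrightarrow> qform n (\<lambda>i. int (m i)) \<nu> \<noteq> 0)"

text \<open>
  The recurrence, solved for \<open>c\<^sub>n\<^sub>,\<^sub>m(\<nu>)\<close>; the argument \<open>m(i := m i - 1)\<close> is \<open>m - e\<^sub>i\<close>.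
  The values are meaningful only if \<^term>\<open>nondegenerate n \<nu>\<close>, where they are characterised by
  the recurrence in its undivided form (\<open>ccoef_recurrence\<close>, \<open>ccoef_unique\<close>).
\<close>

function ccoef :: "nat \<Rightarrow> (nat \<Rightarrow> int) \<Rightarrow> (nat \<Rightarrow> complex) \<Rightarrow> complex" where
  "ccoef n m \<nu> =
     (if \<exists>i\<in>{1..n}. m i < 0 then 0
      else if \<forall>i\<in>{1..n}. m i = 0 then 1
      else ((\<Sum>i=1..n-1. ccoef n (m(i := m i - 1)) \<nu>) + 1/2 * ccoef n (m(n := m n - 1)) \<nu>)
             / qform n m \<nu>)"
  by pat_completeness auto
termination
proof -
  have less: "(\<Sum>j=1..n. nat ((m(i := m i - 1)) j + 1)) < (\<Sum>j=1..n. nat (m j + 1))"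
    if "\<not> (\<exists>j\<in>{1..n}. m j < 0)" "i \<in> {1..n}" for n i and m :: "nat \<Rightarrow> int"
    by (rule sum_strict_mono_ex1) (use that in \<open>auto intro!: bexI[of _ i] simp: not_less\<close>)
  show ?thesis
  proof (relation "Wellfounded.measure (\<lambda>(n, m, \<nu>). \<Sum>j=1..n. nat (m j + 1))", goal_cases)
    case 1
    then show ?case by simp
  next
    case (2 n m \<nu> i)
    then have "i \<in> {1..n}" by auto
    with less 2 show ?case by (simp del: fun_upd_apply)
  next
    case (3 n m \<nu>)
    then have "n \<in> {1..n}" by (cases n) auto
    with less 3 show ?case by (simp del: fun_upd_apply)
  qed
qed

declare ccoef.simps [simp del]

lemma ccoef_neg: "\<exists>i\<in>{1..n}. m i < 0 \<Longrightarrow> ccoef n m \<nu> = 0"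
  by (simp add: ccoef.simps)

lemma ccoef_zero: "\<forall>i\<in>{1..n}. m i = 0 \<Longrightarrow> ccoef n m \<nu> = 1"
  by (subst ccoef.simps) auto

lemma ccoef_step:
  assumes "\<not> (\<exists>i\<in>{1..n}. m i < 0)" "\<not> (\<forall>i\<in>{1..n}. m i = 0)"
  shows "ccoef n m \<nu> =
    ((\<Sum>i=1..n-1. ccoef n (m(i := m i - 1)) \<nu>) + 1/2 * ccoef n (m(n := m n - 1)) \<nu>) / qform n m \<nu>"
  by (subst ccoef.simps) (simp only: assms if_False)

lemma qform_cong:
  assumes "n \<ge> 1" "\<And>i. i \<in> {1..n} \<Longrightarrow> m i = m' i" "\<And>i. i \<in> {1..n} \<Longrightarrow> \<nu> i = \<nu>' i"
  shows "qform n m \<nu> = qform n m' \<nu>'"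
proof -
  obtain k where "n = Suc k" using \<open>n \<ge> 1\<close> by (cases n) auto
  then show ?thesis unfolding qform_def using assms by simp
qed

lemma qform_nonzero:
  assumes "nondegenerate n \<nu>" "\<forall>i\<in>{1..n}. m i \<ge> 0" "\<exists>i\<in>{1..n}. m i \<noteq> 0"
  shows "qform n m \<nu> \<noteq> 0"
proof -
  have n: "n \<ge> 1" using assms(3) by auto
  have "qform n m \<nu> = qform n (\<lambda>i. int (nat (m i))) \<nu>"
    by (rule qform_cong[OF n]) (use assms(2) in auto)
  moreover have "\<exists>i\<in>{1..n}. nat (m i) \<noteq> 0"
    using assms(2,3) by force
  then have "qform n (\<lambda>i. int (nat (m i))) \<nu> \<noteq> 0"
    using assms(1)[unfolded nondegenerate_def, rule_format, of "\<lambda>i. nat (m i)"] by blast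
  ultimately show ?thesis by simp
qed

lemma ccoef_recurrence:
  assumes "n \<ge> 1" "nondegenerate n \<nu>" "\<forall>i\<in>{1..n}. m i \<ge> 0"
  shows "qform n m \<nu> * ccoef n m \<nu> =
    (\<Sum>i=1..n-1. ccoef n (m(i := m i - 1)) \<nu>) + 1/2 * ccoef n (m(n := m n - 1)) \<nu>"
proof (cases "\<forall>i\<in>{1..n}. m i = 0")
  case True
  have "qform n m \<nu> = 0"
    using qform_cong[OF \<open>n \<ge> 1\<close>, of m "\<lambda>_. 0" \<nu> \<nu>] True by (simp add: qform_def)
  moreover have "ccoef n (m(i := m i - 1)) \<nu> = 0" if "i \<in> {1..n}" for i
    by (rule ccoef_neg) (use True that in \<open>auto intro!: bexI[of _ i]\<close>)
  then have "(\<Sum>i=1..n-1. ccoef n (m(i := m i - 1)) \<nu>) = 0"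
    and "ccoef n (m(n := m n - 1)) \<nu> = 0"
    using \<open>n \<ge> 1\<close> by (auto intro!: sum.neutral simp del: fun_upd_apply)
  ultimately show ?thesis by simp
next
  case False
  then have "qform n m \<nu> \<noteq> 0" using assms qform_nonzero by blast
  with False assms(3) show ?thesis
    by (subst ccoef_step) (auto simp: not_less)
qed

lemma ccoef_unique:
  fixes f :: "(nat \<Rightarrow> int) \<Rightarrow> complex"
  assumes "nondegenerate n \<nu>"
    and "\<And>m. \<exists>i\<in>{1..n}. m i < 0 \<Longrightarrow> f m = 0"
    and "\<And>m. \<forall>i\<in>{1..n}. m i = 0 \<Longrightarrow> f m = 1"
    and "\<And>m. \<forall>i\<in>{1..n}. m i \<ge> 0 \<Longrightarrow> \<exists>i\<in>{1..n}. m i \<noteq> 0 \<Longrightarrow> qform n m \<nu> * f m =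
           (\<Sum>i=1..n-1. f (m(i := m i - 1))) + 1/2 * f (m(n := m n - 1))"
  shows "f m = ccoef n m \<nu>"
  using assms
proof (induction n m \<nu> rule: ccoef.induct)
  case (1 n m \<nu>)
  consider "\<exists>i\<in>{1..n}. m i < 0" | "\<forall>i\<in>{1..n}. m i = 0"
    | "\<not> (\<exists>i\<in>{1..n}. m i < 0)" "\<not> (\<forall>i\<in>{1..n}. m i = 0)" by blast
  then show ?case
  proof cases
    case 1
    then show ?thesis using "1.prems"(2) ccoef_neg by metis
  next
    case 2
    then show ?thesis using "1.prems"(3) ccoef_zero by metis
  next
    case 3
    have nonneg: "\<forall>i\<in>{1..n}. m i \<ge> 0" using 3(1) by force
    have IH1: "f (m(i := m i - 1)) = ccoef n (m(i := m i - 1)) \<nu>" if "i \<in> {1..n-1}" for i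
      using "1.IH"(1)[OF 3 that "1.prems"] by blast
    have IH2: "f (m(n := m n - 1)) = ccoef n (m(n := m n - 1)) \<nu>"
      using "1.IH"(2)[OF 3 "1.prems"] by blast
    have "n \<ge> 1" "\<exists>i\<in>{1..n}. m i \<noteq> 0" using 3(2) by auto
    have "qform n m \<nu> \<noteq> 0"
      using qform_nonzero[OF "1.prems"(1) nonneg] 3(2) by blast
    moreover have "qform n m \<nu> * f m = qform n m \<nu> * ccoef n m \<nu>"
      unfolding "1.prems"(4)[OF nonneg \<open>\<exists>i\<in>{1..n}. m i \<noteq> 0\<close>]
        ccoef_recurrence[OF \<open>n \<ge> 1\<close> "1.prems"(1) nonneg] IH2
      using IH1 by (simp del: fun_upd_apply)
    ultimately show ?thesis by simp
  qed
qed

lemma ccoef_cong: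
  assumes "\<And>i. i \<in> {1..n} \<Longrightarrow> m i = m' i" "\<And>i. i \<in> {1..n} \<Longrightarrow> \<nu> i = \<nu>' i"
  shows "ccoef n m \<nu> = ccoef n m' \<nu>'"
  using assms
proof (induction n m \<nu> arbitrary: m' rule: ccoef.induct)
  case (1 n m \<nu>)
  consider "\<exists>i\<in>{1..n}. m i < 0" | "\<forall>i\<in>{1..n}. m i = 0"
    | "\<not> (\<exists>i\<in>{1..n}. m i < 0)" "\<not> (\<forall>i\<in>{1..n}. m i = 0)" by blast
  then show ?case
  proof cases
    case 1
    then show ?thesis using "1.prems"(1) ccoef_neg by metis
  next
    case 2
    then show ?thesis using "1.prems"(1) ccoef_zero by metis
  next
    case 3
    then have 4: "\<not> (\<exists>i\<in>{1..n}. m' i < 0)" "\<not> (\<forall>i\<in>{1..n}. m' i = 0)" and "n \<ge> 1"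
      using "1.prems"(1) by auto
    have IH1: "ccoef n (m(i := m i - 1)) \<nu> = ccoef n (m'(i := m' i - 1)) \<nu>'"
      if "i \<in> {1..n-1}" for i
      by (rule "1.IH"(1)[OF 3 that]) (use "1.prems" that in auto)
    have IH2: "ccoef n (m(n := m n - 1)) \<nu> = ccoef n (m'(n := m' n - 1)) \<nu>'"
      by (rule "1.IH"(2)[OF 3]) (use "1.prems" in auto)
    have "qform n m \<nu> = qform n m' \<nu>'"
      using qform_cong[OF \<open>n \<ge> 1\<close>] "1.prems" by blast
    then show ?thesis
      unfolding ccoef_step[OF 3] ccoef_step[OF 4] IH2
      using IH1 by (simp del: fun_upd_apply)
  qed
qed

definition weyl_group :: "nat \<Rightarrow> ((nat \<Rightarrow> complex) \<Rightarrow> (nat \<Rightarrow> complex)) set" where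
  "weyl_group n =
     {(\<lambda>\<nu> i. s i * \<nu> (p i)) | s p.
        p permutes {1..n} \<and> (\<forall>i\<in>{1..n}. s i \<in> {1, -1}) \<and> (\<forall>i. i \<notin> {1..n} \<longrightarrow> s i = 1)}"

definition unit_vec :: "nat \<Rightarrow> nat \<Rightarrow> complex" where
  "unit_vec i j = (if j = i then 1 else 0)"

definition simple_root :: "nat \<Rightarrow> nat \<Rightarrow> nat \<Rightarrow> complex" where
  "simple_root n i j =
     (if i < n then 1/2 * (unit_vec i j - unit_vec (i+1) j) else 1/2 * unit_vec n j)"

definition in_root_lattice :: "nat \<Rightarrow> (nat \<Rightarrow> complex) \<Rightarrow> bool" where
  "in_root_lattice n v \<longleftrightarrow>
     (\<exists>a :: nat \<Rightarrow> int. \<forall>j\<in>{1..n}. v j = (\<Sum>i=1..n. of_int (a i) * simple_root n i j))"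

definition regular :: "nat \<Rightarrow> (nat \<Rightarrow> complex) \<Rightarrow> bool" where
  "regular n \<nu> \<longleftrightarrow>
     (\<forall>w\<in>weyl_group n. nondegenerate n (w \<nu>)) \<and>
     (\<forall>w\<in>weyl_group n. \<forall>w'\<in>weyl_group n. w \<noteq> w' \<longrightarrow> \<not> in_root_lattice n (\<lambda>j. w \<nu> j - w' \<nu> j))"

text \<open>
  Regularity of \<open>\<nu>\<close> makes the coefficients attached to all truncations
  \<open>(\<nu>\<^sub>1, \<dots>, \<nu>\<^sub>j)\<close> well defined, because \<open>q\<^sub>j\<close> is the restriction of \<open>q\<^sub>n\<close> to the vectors
  \<open>(m\<^sub>1, \<dots>, m\<^sub>j, m\<^sub>j, \<dots>, m\<^sub>j)\<close>.
\<close>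

lemma nondegenerate_truncate_Suc:
  assumes "n \<ge> 1" "nondegenerate (Suc n) \<nu>"
  shows "nondegenerate n \<nu>"
  unfolding nondegenerate_def
proof (intro allI impI)
  fix m :: "nat \<Rightarrow> nat"
  assume m: "\<exists>i\<in>{1..n}. m i \<noteq> 0"
  define m' where "m' = m(Suc n := m n)"
  obtain k where k: "n = Suc k" using \<open>n \<ge> 1\<close> by (cases n) auto
  from m obtain i where "i \<in> {1..n}" "m i \<noteq> 0" by blast
  then have "\<exists>i\<in>{1..Suc n}. m' i \<noteq> 0" by (auto simp: m'_def intro!: bexI[of _ i])
  then have "qform (Suc n) (\<lambda>i. int (m' i)) \<nu> \<noteq> 0"
    using assms(2) unfolding nondegenerate_def by blast
  moreover have "qform (Suc n) (\<lambda>i. int (m' i)) \<nu> = qform n (\<lambda>i. int (m i)) \<nu>"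
    unfolding qform_def m'_def k by (simp add: power2_eq_square algebra_simps)
  ultimately show "qform n (\<lambda>i. int (m i)) \<nu> \<noteq> 0" by simp
qed

lemma regular_imp_nondegenerate:
  assumes "regular n \<nu>" "1 \<le> j" "j \<le> n"
  shows "nondegenerate j \<nu>"
  using assms(3)
proof (induction rule: inc_induct)
  case base
  have "(\<lambda>\<nu> i. 1 * \<nu> (id i)) \<in> weyl_group n"
    unfolding weyl_group_def by (rule CollectI, rule exI[of _ "\<lambda>_. 1"], rule exI[of _ id])
      (auto simp: permutes_id)
  then show ?case
    using assms(1) unfolding regular_def by fastforce
next
  case (step k)
  then show ?case using nondegenerate_truncate_Suc assms(2) by simp
qed

text \<open>
  The pairs \<open>(l, k)\<close> over which the sum runs. Setting all entries outside \<open>{1..n-1}\<close> to zero makes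
  \<open>l\<close> and \<open>k\<close> determined by their relevant entries and encodes the convention \<open>l\<^sub>0 = k\<^sub>0 = 0\<close>.
\<close>

definition sum_range :: "nat \<Rightarrow> (nat \<Rightarrow> nat) \<Rightarrow> ((nat \<Rightarrow> nat) \<times> (nat \<Rightarrow> nat)) set" where
  "sum_range n m =
     {(l, k). (\<forall>i\<in>{1..n-1}. k i \<le> l i \<and> l i \<le> m i) \<and> k (n-1) \<le> m n \<and>
              (\<forall>i. i \<notin> {1..n-1} \<longrightarrow> l i = 0 \<and> k i = 0)}"

lemma finite_sum_range: "finite (sum_range n m)"
proof -
  define B where "B = (\<Sum>i=1..n-1. m i)"
  define F where
    "F = {f. \<forall>i. (i \<in> {1..n-1} \<longrightarrow> f i \<in> {..B}) \<and> (i \<notin> {1..n-1} \<longrightarrow> f i = 0)}"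
  have "finite F" unfolding F_def by (rule finite_set_of_finite_funs) auto
  moreover have "sum_range n m \<subseteq> F \<times> F"
  proof
    fix x assume "x \<in> sum_range n m"
    moreover obtain l k where x: "x = (l, k)" by (cases x)
    ultimately have lk: "\<And>i. i \<in> {1..n-1} \<Longrightarrow> k i \<le> l i \<and> l i \<le> m i"
      "\<And>i. i \<notin> {1..n-1} \<Longrightarrow> l i = 0 \<and> k i = 0"
      unfolding sum_range_def by blast+
    have "m i \<le> B" if "i \<in> {1..n-1}" for i
      unfolding B_def by (rule member_le_sum) (use that in auto)
    then have "k i \<le> B \<and> l i \<le> B" if "i \<in> {1..n-1}" for i
      using lk(1)[OF that] that by (meson order_trans)
    with lk(2) show "x \<in> F \<times> F" unfolding F_def x by blast
  qed
  ultimately show ?thesis by (meson finite_SigmaI finite_subset)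
qed

end

theory Submission
  imports Defs
begin

text \<open>
  By uniqueness of the coefficients it suffices that the right-hand side \<open>S(m)\<close> satisfies the
  recurrence. Its summand is \<open>c(k) W(m, l, k)\<close> with \<open>W\<close> a product of reciprocal Gamma functions, so
  shifting an entry of \<open>m\<close>, \<open>l\<close> or \<open>k\<close> by one multiplies \<open>W\<close> by a polynomial. Summation by parts in
  each \<open>l\<^sub>i\<close> gives relations between sums of such multiples of \<open>c W\<close>; shifting each \<open>k\<^sub>i\<close> and applying the
  recurrence for \<open>c\<close> gives one more. The recurrence for \<open>S\<close> is the sum of these relations, by a
  polynomial identity in \<open>m\<close>, \<open>l\<close>, \<open>k\<close> and \<open>\<nu>\<close>. Regularity enters in the initial condition
  \<open>S(0) = 1\<close>, where it makes the Gamma factors finite.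
\<close>

section \<open>Reciprocal Pochhammer symbols\<close>

text \<open>
  The reciprocal of \<^const>\<open>poch\<close> in a form for which the shift rule \<open>rpoch_pred\<close> holds without any
  condition on \<open>a\<close>. For \<open>a = 1\<close> it is \<open>1/k!\<close>, extended by \<open>0\<close> to negative \<open>k\<close>.
\<close>

definition rpoch :: "complex \<Rightarrow> int \<Rightarrow> complex" where
  "rpoch a k = Gamma a * rGamma (a + of_int k)"

text \<open>\<open>Gamma\<close> is the inverse of \<open>rGamma\<close> even at its poles, where it
  is 0, so no condition on \<open>a\<close> arises.\<close>

lemma inverse_poch: "1 / poch a k = rpoch a k"
  by (simp add: poch_def rpoch_def Gamma_def field_simps)

text \<open>The functional equation of \<open>rGamma\<close> holds on the whole plane, including the
  poles of \<open>Gamma\<close>.\<close>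

lemma rpoch_pred: "rpoch a (k - 1) = (a + of_int k - 1) * rpoch a k"
  using rGamma_plus1[of "a + of_int k - 1"] by (simp add: rpoch_def algebra_simps)

lemma rpoch_0: "a \<notin> \<int>\<^sub>\<le>\<^sub>0 \<Longrightarrow> rpoch a 0 = 1"
  by (simp add: rpoch_def Gamma_def rGamma_eq_zero_iff)

lemma rpoch_1_nat: "rpoch 1 (int k) = 1 / fact k"
  using Gamma_fact[of k, where ?'a = complex] by (simp add: rpoch_def rGamma_inverse_Gamma field_simps)

lemma rpoch_1_diff: "l \<le> m \<Longrightarrow> rpoch 1 (int m - int l) = 1 / fact (m - l)"
  using rpoch_1_nat[of "m - l"] by (simp add: of_nat_diff)

text \<open>For negative \<open>k\<close> the argument 1 + k is a pole of Gamma, hence a zero of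
  \<open>rGamma\<close>. These zeros later stand in for the bounds on the summation indices.\<close>

lemma rpoch_1_neg: "k < 0 \<Longrightarrow> rpoch 1 k = 0"
proof -
  assume "k < 0"
  then have "(1 + of_int k :: complex) = - of_nat (nat (- k - 1))" by simp
  then have "(1 + of_int k :: complex) \<in> \<int>\<^sub>\<le>\<^sub>0" by (metis nonpos_Ints_of_int minus_of_nat_in_nonpos_Ints)
  then show ?thesis by (simp add: rpoch_def rGamma_eq_zero_iff)
qed

section \<open>Kernels and their shift rules\<close>

lemma prod_scale_one_factor:
  fixes g h :: "'a \<Rightarrow> 'b :: comm_monoid_mult"
  assumes "finite A" "j \<in> A" "g j = c * h j" "\<And>i. i \<in> A \<Longrightarrow> i \<noteq> j \<Longrightarrow> g i = h i"
  shows "prod g A = c * prod h A"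
proof -
  have "prod g (A - {j}) = prod h (A - {j})" using assms(4) by (intro prod.cong) auto
  then show ?thesis
    using assms(1-3) by (simp add: prod.remove[of A j g] prod.remove[of A j h] mult.assoc)
qed

text \<open>Equal to the product of the 1/(x_i - y_i)! if y \<le> x on {1..n} and to 0 otherwise, so
  it also encodes the range of summation.\<close>

definition diag_kernel :: "nat \<Rightarrow> (nat \<Rightarrow> int) \<Rightarrow> (nat \<Rightarrow> int) \<Rightarrow> complex" where
  "diag_kernel n x y = (\<Prod>i=1..n. rpoch 1 (x i - y i))"

text \<open>The entry y_j is paired with x_(j+1), so y_0 occurs and y_n does not.\<close>

definition offdiag_kernel ::
    "nat \<Rightarrow> (nat \<Rightarrow> complex) \<Rightarrow> (nat \<Rightarrow> int) \<Rightarrow> (nat \<Rightarrow> int) \<Rightarrow> complex" where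
  "offdiag_kernel n a x y = (\<Prod>i=1..n. rpoch (a i) (x i - y (i-1)))"

text \<open>The update lowers the single difference x_j - y_j by one, as does raising y_j;
  \<open>rpoch_pred\<close> at a = 1 supplies the factor.\<close>

lemma diag_kernel_upd_left:
  assumes "j \<in> {1..n}"
  shows "diag_kernel n (x(j := x j - 1)) y = of_int (x j - y j) * diag_kernel n x y"
  unfolding diag_kernel_def
  by (rule prod_scale_one_factor[of _ j])
    (use assms rpoch_pred[of 1 "x j - y j"] in \<open>auto simp: algebra_simps\<close>)

lemma diag_kernel_upd_right:
  assumes "j \<in> {1..n}"
  shows "diag_kernel n x (y(j := y j + 1)) = of_int (x j - y j) * diag_kernel n x y"
  unfolding diag_kernel_def
  by (rule prod_scale_one_factor[of _ j])
    (use assms rpoch_pred[of 1 "x j - y j"] in \<open>auto simp: algebra_simps\<close>)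

lemma diag_kernel_eq_0: "i \<in> {1..n} \<Longrightarrow> x i < y i \<Longrightarrow> diag_kernel n x y = 0"
  unfolding diag_kernel_def by (rule prod_zero) (auto intro!: bexI[of _ i] rpoch_1_neg)

lemma offdiag_kernel_upd_left:
  assumes "j \<in> {1..n}"
  shows "offdiag_kernel n a (x(j := x j - 1)) y
       = (a j + of_int (x j - y (j-1)) - 1) * offdiag_kernel n a x y"
  unfolding offdiag_kernel_def
  by (rule prod_scale_one_factor[of _ j])
    (use assms rpoch_pred[of "a j" "x j - y (j-1)"] in \<open>auto simp: algebra_simps\<close>)

lemma offdiag_kernel_upd_right:
  assumes "Suc j \<in> {1..n}"
  shows "offdiag_kernel n a x (y(j := y j + 1))
       = (a (Suc j) + of_int (x (Suc j) - y j) - 1) * offdiag_kernel n a x y"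
  unfolding offdiag_kernel_def
  by (rule prod_scale_one_factor[of _ "Suc j"])
    (use assms rpoch_pred[of "a (Suc j)" "x (Suc j) - y j"] in \<open>auto simp: algebra_simps\<close>)

lemma offdiag_kernel_upd_right_last:
  "offdiag_kernel n a x (y(n := v)) = offdiag_kernel n a x y"
  unfolding offdiag_kernel_def by (intro prod.cong) auto

lemma diag_kernel_upd_outside:
  "j \<notin> {1..n} \<Longrightarrow> diag_kernel n (x(j := v)) y = diag_kernel n x y"
  unfolding diag_kernel_def by (intro prod.cong) auto

section \<open>The weight and its shift rules\<close>

text \<open>
  The summand of the recursion for rank \<open>n = Suc N\<close>, without its coefficient. The vector \<open>l\<close> enters
  twice, since the telescoping argument shifts its two occurrences separately.
\<close>

definition weight ::
    "nat \<Rightarrow> (nat \<Rightarrow> complex) \<Rightarrow> (nat \<Rightarrow> int) \<Rightarrow> (nat \<Rightarrow> int) \<Rightarrow> (nat \<Rightarrow> int) \<Rightarrow> (nat \<Rightarrow> int) \<Rightarrow> complex"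
  where
  "weight N \<nu> m l l' k =
     diag_kernel N m l * offdiag_kernel (Suc N) (\<lambda>i. \<nu> i + \<nu> (Suc N) + 1) m l
     * rpoch 1 (m (Suc N) - k N)
     * (diag_kernel N l' k * offdiag_kernel N (\<lambda>i. \<nu> i - \<nu> (Suc N) + 1) l' k)"

text \<open>The entry m_j occurs in one factor of each of the first two kernels; the 1 in the
  parameter cancels the -1 of \<open>rpoch_pred\<close>.\<close>

lemma weight_upd_m:
  assumes "j \<in> {1..N}"
  shows "weight N \<nu> (m(j := m j - 1)) l l' k =
    of_int (m j - l j) * (of_int (m j - l (j-1)) + \<nu> j + \<nu> (Suc N)) * weight N \<nu> m l l' k"
  using assms offdiag_kernel_upd_left[of j "Suc N" _ m l] diag_kernel_upd_left[OF assms, of m l]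
  by (simp add: weight_def)

text \<open>The last entry of \<open>m\<close> lies outside the diagonal kernel. It occurs in the
  separate reciprocal factorial and in the last off-diagonal factor, whose parameter is
  \<open>2 * \<nu> (Suc N) + 1\<close>.\<close>

lemma weight_upd_m_last:
  "weight N \<nu> (m(Suc N := m (Suc N) - 1)) l l' k =
    of_int (m (Suc N) - k N) * (of_int (m (Suc N) - l N) + 2 * \<nu> (Suc N)) * weight N \<nu> m l l' k"
proof -
  have eq: "m (Suc N) - 1 - k N = m (Suc N) - k N - 1" by simp
  have "rpoch 1 (m (Suc N) - 1 - k N) = of_int (m (Suc N) - k N) * rpoch 1 (m (Suc N) - k N)"
    unfolding eq using rpoch_pred[of 1 "m (Suc N) - k N"] by simp
  then show ?thesis
    by (simp add: weight_def offdiag_kernel_upd_left diag_kernel_upd_outside)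
qed

lemma weight_upd_l:
  assumes "j \<in> {1..N}"
  shows "weight N \<nu> m (l(j := l j + 1)) l' k =
    of_int (m j - l j) * (of_int (m (Suc j) - l j) + \<nu> (Suc j) + \<nu> (Suc N)) * weight N \<nu> m l l' k"
  using assms offdiag_kernel_upd_right[of j "Suc N" _ m l] diag_kernel_upd_right[OF assms, of m l]
  by (simp add: weight_def)

lemma weight_upd_l':
  assumes "j \<in> {1..N}"
  shows "weight N \<nu> m l (l'(j := l' j - 1)) k =
    of_int (l' j - k j) * (of_int (l' j - k (j-1)) + \<nu> j - \<nu> (Suc N)) * weight N \<nu> m l l' k"
  using assms offdiag_kernel_upd_left[of j N _ l' k] diag_kernel_upd_left[OF assms, of l' k]
  by (simp add: weight_def)

lemma weight_upd_k:
  assumes "j \<in> {1..N-1}"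
  shows "weight N \<nu> m l l' (k(j := k j + 1)) =
    of_int (l' j - k j) * (of_int (l' (Suc j) - k j) + \<nu> (Suc j) - \<nu> (Suc N)) * weight N \<nu> m l l' k"
  using assms offdiag_kernel_upd_right[of j N _ l' k] diag_kernel_upd_right[of j N l' k]
  by (auto simp: weight_def)

text \<open>The off-diagonal kernel of \<open>l'\<close> and \<open>k\<close> does not contain
  \<open>k N\<close>; the separate reciprocal factorial does, so the multiplier is free of
  \<nu>.\<close>

lemma weight_upd_k_last:
  assumes "N \<ge> 1"
  shows "weight N \<nu> m l l' (k(N := k N + 1)) =
    of_int (m (Suc N) - k N) * of_int (l' N - k N) * weight N \<nu> m l l' k"
  using assms offdiag_kernel_upd_right_last[of N _ l' k] diag_kernel_upd_right[of N N l' k]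
    rpoch_pred[of 1 "m (Suc N) - k N"]
  by (simp add: weight_def diff_diff_eq[symmetric])

lemma weight_eq_0:
  assumes "i \<in> {1..N}" "m i < l i \<or> l' i < k i"
  shows "weight N \<nu> m l l' k = 0"
  using assms diag_kernel_eq_0[of i N] by (auto simp: weight_def)

section \<open>Index sets and reindexing\<close>

text \<open>Unlike a box, this set is stable under shifts at indices in {1..N}, which are bijections
  of it. It also encodes l_0 = k_0 = 0.\<close>

definition supp_on :: "nat \<Rightarrow> (nat \<Rightarrow> int) set" where
  "supp_on N = {f. \<forall>i. i \<notin> {1..N} \<longrightarrow> f i = 0}"

text \<open>The product of two such boxes contains the range of summation of the theorem; the
  surplus pairs contribute 0.\<close>

definition int_box :: "nat \<Rightarrow> (nat \<Rightarrow> int) \<Rightarrow> (nat \<Rightarrow> int) set" where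
  "int_box N m = {f \<in> supp_on N. \<forall>i\<in>{1..N}. 0 \<le> f i \<and> f i \<le> m i}"

lemma finite_int_box: "finite (int_box N m)"
proof -
  define B where "B = (\<Sum>i=1..N. \<bar>m i\<bar>)"
  have le: "m i \<le> B" if "i \<in> {1..N}" for i
    using member_le_sum[of i "{1..N}" "\<lambda>i. \<bar>m i\<bar>"] that unfolding B_def by force
  have "finite {f. \<forall>i. (i \<in> {1..N} \<longrightarrow> f i \<in> {0..B}) \<and> (i \<notin> {1..N} \<longrightarrow> f i = 0)}"
    by (rule finite_set_of_finite_funs) auto
  moreover have "int_box N m \<subseteq> {f. \<forall>i. (i \<in> {1..N} \<longrightarrow> f i \<in> {0..B}) \<and> (i \<notin> {1..N} \<longrightarrow> f i = 0)}"
  proof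
    fix f assume f: "f \<in> int_box N m"
    then have "f i \<in> {0..B}" if "i \<in> {1..N}" for i
      using le[OF that] that unfolding int_box_def by fastforce
    with f show "f \<in> {f. \<forall>i. (i \<in> {1..N} \<longrightarrow> f i \<in> {0..B}) \<and> (i \<notin> {1..N} \<longrightarrow> f i = 0)}"
      unfolding int_box_def supp_on_def by blast
  qed
  ultimately show ?thesis by (rule rev_finite_subset)
qed

text \<open>Both sums are extended to the union of \<open>A\<close> and its image under \<sigma>. On
  image points outside \<open>A\<close> the function vanishes by assumption; a point of
  \<open>A\<close> outside the image is \<sigma> y with y outside \<open>A\<close>, where
  \<open>F (\<sigma> y)\<close> is 0.\<close>

lemma sum_reindex_supported:
  assumes "finite A" "A \<subseteq> X" "bij_betw \<sigma> X X"
    and "\<And>x. x \<in> X - A \<Longrightarrow> F x = 0" "\<And>x. x \<in> X - A \<Longrightarrow> F (\<sigma> x) = 0"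
  shows "(\<Sum>x\<in>A. F (\<sigma> x)) = (\<Sum>x\<in>A. F x)"
proof -
  have inj: "inj_on \<sigma> A" using assms(2,3) by (meson bij_betw_imp_inj_on inj_on_subset)
  have img: "\<sigma> ` A \<subseteq> X" using assms(2,3) by (auto simp: bij_betw_def)
  have "(\<Sum>x\<in>A. F (\<sigma> x)) = sum F (\<sigma> ` A)" using inj by (simp add: sum.reindex)
  also have "\<dots> = sum F (A \<union> \<sigma> ` A)"
  proof (rule sum.mono_neutral_left)
    show "\<forall>x\<in>A \<union> \<sigma> ` A - \<sigma> ` A. F x = 0"
    proof
      fix x assume x: "x \<in> A \<union> \<sigma> ` A - \<sigma> ` A"
      then have "x \<in> \<sigma> ` X" using assms(2,3) img unfolding bij_betw_def by blast
      then obtain y where "y \<in> X" "x = \<sigma> y" by blast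
      with x show "F x = 0" using assms(5)[of y] by auto
    qed
  qed (use assms in auto)
  also have "\<dots> = sum F A"
    by (rule sum.mono_neutral_right) (use assms img in auto)
  finally show ?thesis .
qed

lemma int_box_subset: "int_box N m \<subseteq> supp_on N"
  by (auto simp: int_box_def)

section \<open>Summation by parts\<close>

text \<open>The right-hand side of the theorem, for arbitrary integer vectors \<open>m\<close>.\<close>

definition rec_sum :: "nat \<Rightarrow> (nat \<Rightarrow> complex) \<Rightarrow> (nat \<Rightarrow> int) \<Rightarrow> complex" where
  "rec_sum N \<nu> m = (\<Sum>(l, k)\<in>int_box N m \<times> int_box N m. ccoef N k \<nu> * weight N \<nu> m l l k)"

lemma mem_int_box_pair:
  assumes "l \<in> supp_on N" "k \<in> supp_on N"
    and "\<forall>i\<in>{1..N}. 0 \<le> k i \<and> k i \<le> l i \<and> l i \<le> m i"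
  shows "(l, k) \<in> int_box N m \<times> int_box N m"
  using assms by (force simp: int_box_def)

text \<open>A negative entry of \<open>k\<close> kills the coefficient, and a violation of k \<le> l
  or l \<le> m kills the weight.\<close>

lemma summand_eq_0:
  assumes "l \<in> supp_on N" "k \<in> supp_on N" "(l, k) \<notin> int_box N m \<times> int_box N m"
  shows "ccoef N k \<nu> * weight N \<nu> m l l k = 0"
proof (rule ccontr)
  assume "\<not> ?thesis"
  then have "\<forall>i\<in>{1..N}. 0 \<le> k i \<and> k i \<le> l i \<and> l i \<le> m i"
    using ccoef_neg[of N k \<nu>] weight_eq_0[of _ N m l l k \<nu>] by force
  with mem_int_box_pair assms show False by blast
qed

lemma sum_int_box_reindex:
  fixes F :: "(nat \<Rightarrow> int) \<times> (nat \<Rightarrow> int) \<Rightarrow> complex"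
  assumes bij: "bij_betw \<sigma> (supp_on N \<times> supp_on N) (supp_on N \<times> supp_on N)"
    and F: "\<And>l k i. F (l, k) \<noteq> 0 \<Longrightarrow> i \<in> {1..N} \<Longrightarrow> 0 \<le> k i \<and> k i \<le> l i \<and> l i \<le> m i"
    and F\<sigma>: "\<And>l k i. F (\<sigma> (l, k)) \<noteq> 0 \<Longrightarrow> i \<in> {1..N} \<Longrightarrow> 0 \<le> k i \<and> k i \<le> l i \<and> l i \<le> m i"
  shows "(\<Sum>x\<in>int_box N m \<times> int_box N m. F (\<sigma> x)) = (\<Sum>x\<in>int_box N m \<times> int_box N m. F x)"
proof (rule sum_reindex_supported[OF _ _ bij])
  show "int_box N m \<times> int_box N m \<subseteq> supp_on N \<times> supp_on N" using int_box_subset by blast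
  show "F x = 0" if "x \<in> supp_on N \<times> supp_on N - int_box N m \<times> int_box N m" for x
    using that F mem_int_box_pair[of "fst x" N "snd x" m] by (cases x) fastforce
  show "F (\<sigma> x) = 0" if "x \<in> supp_on N \<times> supp_on N - int_box N m \<times> int_box N m" for x
    using that F\<sigma> mem_int_box_pair[of "fst x" N "snd x" m] by (cases x) fastforce
qed (simp add: finite_int_box)

text \<open>Lowering \<open>m\<close> may shrink the box, but the summands lost are 0. Thus all
  shifted sums live on one common box.\<close>

lemma rec_sum_shift_m:
  "rec_sum N \<nu> (m(j := m j - 1))
    = (\<Sum>(l, k)\<in>int_box N m \<times> int_box N m. ccoef N k \<nu> * weight N \<nu> (m(j := m j - 1)) l l k)"
  unfolding rec_sum_def
proof (rule sum.mono_neutral_left)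
  have "(m(j := m j - 1)) i \<le> m i" for i by simp
  then have "int_box N (m(j := m j - 1)) \<subseteq> int_box N m"
    unfolding int_box_def by (blast intro: order_trans)
  then show "int_box N (m(j := m j - 1)) \<times> int_box N (m(j := m j - 1)) \<subseteq> int_box N m \<times> int_box N m"
    by blast
  show "\<forall>x\<in>int_box N m \<times> int_box N m - int_box N (m(j := m j - 1)) \<times> int_box N (m(j := m j - 1)).
          (case x of (l, k) \<Rightarrow> ccoef N k \<nu> * weight N \<nu> (m(j := m j - 1)) l l k) = 0"
    using int_box_subset by (auto intro!: summand_eq_0 simp del: mult_eq_0_iff)
qed (simp add: finite_int_box)

text \<open>Replacing l_j by l_j + 1 turns the right-hand summand into the left-hand one. Nonzero
  terms have k_j < l_j on the right and l_j < m_j on the left, so none is lost at the boundary of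
  the box.\<close>

lemma sum_shift_l:
  assumes "j \<in> {1..N}"
  shows "(\<Sum>(l, k)\<in>int_box N m \<times> int_box N m. ccoef N k \<nu> * weight N \<nu> m (l(j := l j + 1)) l k)
       = (\<Sum>(l, k)\<in>int_box N m \<times> int_box N m. ccoef N k \<nu> * weight N \<nu> m l (l(j := l j - 1)) k)"
proof -
  define F where "F = (\<lambda>(l, k). ccoef N k \<nu> * weight N \<nu> m l (l(j := l j - 1)) k)"
  define \<sigma> :: "(nat \<Rightarrow> int) \<times> (nat \<Rightarrow> int) \<Rightarrow> _" where "\<sigma> = (\<lambda>(l, k). (l(j := l j + 1), k))"
  have "(\<Sum>x\<in>int_box N m \<times> int_box N m. F (\<sigma> x)) = (\<Sum>x\<in>int_box N m \<times> int_box N m. F x)"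
  proof (rule sum_int_box_reindex)
    show "bij_betw \<sigma> (supp_on N \<times> supp_on N) (supp_on N \<times> supp_on N)"
      by (rule bij_betw_byWitness[of _ "\<lambda>(l, k). (l(j := l j - 1), k)"])
        (use assms in \<open>auto simp: supp_on_def \<sigma>_def\<close>)
    show "0 \<le> k i \<and> k i \<le> l i \<and> l i \<le> m i" if "F (l, k) \<noteq> 0" "i \<in> {1..N}" for l k i
      using that ccoef_neg[of N k \<nu>] weight_eq_0[of i N m l "l(j := l j - 1)" k \<nu>]
      by (cases "i = j") (force simp: F_def)+
    show "0 \<le> k i \<and> k i \<le> l i \<and> l i \<le> m i" if "F (\<sigma> (l, k)) \<noteq> 0" "i \<in> {1..N}" for l k i
      using that ccoef_neg[of N k \<nu>] weight_eq_0[of i N m "l(j := l j + 1)" l k \<nu>]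
      by (cases "i = j") (force simp: F_def \<sigma>_def)+
  qed
  then show ?thesis by (simp add: F_def \<sigma>_def case_prod_unfold)
qed

text \<open>The same substitution in \<open>k\<close>: nonzero terms have k_j < l_j on the left and,
  through the lowered coefficient, k_j > 0 on the right.\<close>

lemma sum_shift_k:
  assumes "j \<in> {1..N}"
  shows "(\<Sum>(l, k)\<in>int_box N m \<times> int_box N m. ccoef N k \<nu> * weight N \<nu> m l l (k(j := k j + 1)))
       = (\<Sum>(l, k)\<in>int_box N m \<times> int_box N m. ccoef N (k(j := k j - 1)) \<nu> * weight N \<nu> m l l k)"
proof -
  define F where "F = (\<lambda>(l, k). ccoef N (k(j := k j - 1)) \<nu> * weight N \<nu> m l l k)"
  define \<sigma> :: "(nat \<Rightarrow> int) \<times> (nat \<Rightarrow> int) \<Rightarrow> _" where "\<sigma> = (\<lambda>(l, k). (l, k(j := k j + 1)))"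
  have "(\<Sum>x\<in>int_box N m \<times> int_box N m. F (\<sigma> x)) = (\<Sum>x\<in>int_box N m \<times> int_box N m. F x)"
  proof (rule sum_int_box_reindex)
    show "bij_betw \<sigma> (supp_on N \<times> supp_on N) (supp_on N \<times> supp_on N)"
      by (rule bij_betw_byWitness[of _ "\<lambda>(l, k). (l, k(j := k j - 1))"])
        (use assms in \<open>auto simp: supp_on_def \<sigma>_def\<close>)
    show "0 \<le> k i \<and> k i \<le> l i \<and> l i \<le> m i" if "F (l, k) \<noteq> 0" "i \<in> {1..N}" for l k i
    proof -
      have "\<not> (k(j := k j - 1)) i < 0"
        using that ccoef_neg[of N "k(j := k j - 1)" \<nu>] by (force simp: F_def)
      then have "0 \<le> k i" by (cases "i = j") auto
      then show ?thesis using that weight_eq_0[of i N m l l k \<nu>] by (force simp: F_def)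
    qed
    show "0 \<le> k i \<and> k i \<le> l i \<and> l i \<le> m i" if "F (\<sigma> (l, k)) \<noteq> 0" "i \<in> {1..N}" for l k i
      using that ccoef_neg[of N k \<nu>] weight_eq_0[of i N m l l "k(j := k j + 1)" \<nu>]
      by (cases "i = j") (force simp: F_def \<sigma>_def)+
  qed
  then show ?thesis by (simp add: F_def \<sigma>_def case_prod_unfold)
qed

section \<open>The polynomial identity\<close>

text \<open>Each summand is the difference of the right-hand side at i and at i - 1, as polynomials.
  The value at 0 vanishes because L_0 = K_0 = 0.\<close>

lemma telescoping_identity:
  fixes M L K \<nu> :: "nat \<Rightarrow> complex"
  assumes "L 0 = 0" "K 0 = 0"
  shows "(\<Sum>i=1..r. M i ^ 2 - M i * M (Suc i) + (\<nu> i - \<nu> (Suc i)) * M i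
      - (M i - L i) * (M i - L (i-1) + \<nu> i + z) + (M i - L i) * (M (Suc i) - L i + \<nu> (Suc i) + z)
      - (L i - K i) * (L i - K (i-1) + \<nu> i - z)
      - (K i ^ 2 - K i * K (Suc i) + (\<nu> i - \<nu> (Suc i)) * K i
         - (L i - K i) * (L (Suc i) - K i + \<nu> (Suc i) - z)))
    = L (Suc r) * L r + K (Suc r) * K r - M (Suc r) * L r - L (Suc r) * K r"
proof (induction r)
  case 0
  then show ?case using assms by simp
next
  case (Suc r)
  show ?case
    unfolding sum.cl_ivl_Suc Suc.IH by (simp add: algebra_simps power2_eq_square)
qed

text \<open>The subtracted and added products are the multipliers of the weight under shifts of
  \<open>m\<close>, \<open>k\<close> and the two copies of \<open>l\<close>. Indices up to N - 1
  telescope; the remaining terms are compared directly.\<close>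

lemma qform_identity:
  fixes \<nu> :: "nat \<Rightarrow> complex" and m l k :: "nat \<Rightarrow> int"
  assumes "l 0 = 0" "k 0 = 0" "N \<ge> 1"
  shows "qform (Suc N) m \<nu>
      - (\<Sum>i=1..N. of_int (m i - l i) * (of_int (m i - l (i-1)) + \<nu> i + \<nu> (Suc N)))
      - 1/2 * (of_int (m (Suc N) - k N) * (of_int (m (Suc N) - l N) + 2 * \<nu> (Suc N)))
    = qform N k \<nu>
      - (\<Sum>i=1..N-1. of_int (l i - k i) * (of_int (l (Suc i) - k i) + \<nu> (Suc i) - \<nu> (Suc N)))
      - 1/2 * (of_int (m (Suc N) - k N) * of_int (l N - k N))
      + (\<Sum>i=1..N. of_int (l i - k i) * (of_int (l i - k (i-1)) + \<nu> i - \<nu> (Suc N)))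
      - (\<Sum>i=1..N. of_int (m i - l i) * (of_int (m (Suc i) - l i) + \<nu> (Suc i) + \<nu> (Suc N)))"
proof -
  obtain r where N: "N = Suc r" using assms(3) by (cases N) auto
  define z where "z = \<nu> (Suc N)"
  define M L K :: "nat \<Rightarrow> complex"
    where "M i = of_int (m i)" and "L i = of_int (l i)" and "K i = of_int (k i)" for i
  \<comment> \<open>Opaque names for the summands make the final combination linear in their sums
    and the end terms.\<close>
  define a b c where "a i = M i ^ 2" and "b i = M i * M (Suc i)" and "c i = (\<nu> i - \<nu> (Suc i)) * M i" for i
  define a' b' c' where "a' i = K i ^ 2" and "b' i = K i * K (Suc i)" and "c' i = (\<nu> i - \<nu> (Suc i)) * K i" for i
  define f g h h' where "f i = (M i - L i) * (M i - L (i-1) + \<nu> i + z)"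
    and "g i = (L i - K i) * (L (Suc i) - K i + \<nu> (Suc i) - z)"
    and "h i = (M i - L i) * (M (Suc i) - L i + \<nu> (Suc i) + z)"
    and "h' i = (L i - K i) * (L i - K (i-1) + \<nu> i - z)" for i
  note term_defs = a_def b_def c_def a'_def b'_def c'_def f_def g_def h_def h'_def
  define P P' R R' X where "P = 1/2 * M (Suc N) ^ 2 + z * M (Suc N)"
    and "P' = 1/2 * K N ^ 2 + \<nu> N * K N"
    and "R = 1/2 * ((M (Suc N) - K N) * (M (Suc N) - L N + 2 * z))"
    and "R' = 1/2 * ((M (Suc N) - K N) * (L N - K N))"
    and "X = L N * L r + K N * K r - M N * L r - L N * K r"
  note end_defs = P_def P'_def R_def R'_def X_def
  have "(\<Sum>i=1..r. a i - b i + c i - f i + h i - h' i - (a' i - b' i + c' i - g i)) = X"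
    unfolding term_defs X_def N using assms(1,2) by (intro telescoping_identity) (simp_all add: L_def K_def)
  then have tele: "X = sum a {1..r} - sum b {1..r} + sum c {1..r} - sum f {1..r} + sum h {1..r} - sum h' {1..r}
      - (sum a' {1..r} - sum b' {1..r} + sum c' {1..r} - sum g {1..r})"
    by (simp only: sum.distrib sum_subtractf)
  \<comment> \<open>Everything outside the telescoping range: index N of the longer sums, the last
    terms of both quadratic forms, and the halved shift multipliers.\<close>
  have last: "P' = a N - b N + c N - f N + h N - h' N + P - R + R' + X"
    unfolding term_defs end_defs N z_def by (simp add: field_simps power2_eq_square)
  have q: "qform (Suc N) m \<nu> = sum a {1..N} - sum b {1..N} + sum c {1..N} + P"
    unfolding qform_def term_defs end_defs M_def z_def by simp
  have q': "qform N k \<nu> = sum a' {1..r} - sum b' {1..r} + sum c' {1..r} + P'"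
    unfolding qform_def term_defs end_defs K_def N by simp
  have split: "sum u {1..N} = sum u {1..r} + u N" for u :: "nat \<Rightarrow> complex"
    by (simp add: N)
  have "qform (Suc N) m \<nu> - sum f {1..N} - R = qform N k \<nu> - sum g {1..r} - R' + sum h' {1..N} - sum h {1..N}"
    unfolding q q' split last tele by (simp only: algebra_simps)
  then show ?thesis
    unfolding term_defs end_defs M_def L_def K_def z_def by (simp add: N)
qed

section \<open>Recurrence and initial values of the right-hand side\<close>

text \<open>\<open>S g\<close> sums the multiplier \<open>g\<close> against the summand of
  \<open>rec_sum\<close>, so every shifted sum becomes some \<open>S g\<close> and the claim reduces
  to linear relations between them.\<close>

lemma rec_sum_recurrence:
  assumes "N \<ge> 1" "nondegenerate N \<nu>"
  shows "qform (Suc N) m \<nu> * rec_sum N \<nu> m =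
    (\<Sum>i=1..N. rec_sum N \<nu> (m(i := m i - 1))) + 1/2 * rec_sum N \<nu> (m(Suc N := m (Suc N) - 1))"
proof -
  define S where "S g = (\<Sum>(l, k)\<in>int_box N m \<times> int_box N m. g l k * (ccoef N k \<nu> * weight N \<nu> m l l k))"
    for g :: "(nat \<Rightarrow> int) \<Rightarrow> (nat \<Rightarrow> int) \<Rightarrow> complex"
  have S_add: "S (\<lambda>l k. g l k + h l k) = S g + S h" and S_diff: "S (\<lambda>l k. g l k - h l k) = S g - S h"
    and S_half: "S (\<lambda>l k. g l k / 2) = S g / 2" for g h
    by (simp_all add: S_def case_prod_unfold sum.distrib sum_subtractf sum_divide_distrib algebra_simps)
  have S_sum: "S (\<lambda>l k. \<Sum>i\<in>I. g i l k) = (\<Sum>i\<in>I. S (g i))" for I :: "nat set" and g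
    unfolding S_def case_prod_unfold sum_distrib_right by (rule sum.swap)
  have S_cong: "S g = S h" if "\<And>l k. l \<in> int_box N m \<Longrightarrow> k \<in> int_box N m \<Longrightarrow> g l k = h l k" for g h
    unfolding S_def using that by (intro sum.cong) auto
  define f where "f i l k = of_int (m i - l i) * (of_int (m i - l (i-1)) + \<nu> i + \<nu> (Suc N))"
    for i and l k :: "nat \<Rightarrow> int"
  define fN where "fN l k = of_int (m (Suc N) - k N) * (of_int (m (Suc N) - l N) + 2 * \<nu> (Suc N))"
    for l k :: "nat \<Rightarrow> int"
  define g where "g i l k = of_int (l i - k i) * (of_int (l (Suc i) - k i) + \<nu> (Suc i) - \<nu> (Suc N))"
    for i and l k :: "nat \<Rightarrow> int"
  define gN where "gN l k = (of_int (m (Suc N) - k N) * of_int (l N - k N) :: complex)"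
    for l k :: "nat \<Rightarrow> int"
  define h where "h i l k = of_int (m i - l i) * (of_int (m (Suc i) - l i) + \<nu> (Suc i) + \<nu> (Suc N))"
    for i and l k :: "nat \<Rightarrow> int"
  define h' where "h' i l k = of_int (l i - k i) * (of_int (l i - k (i-1)) + \<nu> i - \<nu> (Suc N))"
    for i and l k :: "nat \<Rightarrow> int"
  have f: "rec_sum N \<nu> (m(i := m i - 1)) = S (f i)" if "i \<in> {1..N}" for i
    unfolding rec_sum_shift_m S_def f_def weight_upd_m[OF that] by (simp add: mult_ac)
  have fN: "rec_sum N \<nu> (m(Suc N := m (Suc N) - 1)) = S fN"
    unfolding rec_sum_shift_m S_def fN_def weight_upd_m_last by (simp add: mult_ac)
  have h: "S (h i) = S (h' i)" if "i \<in> {1..N}" for i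
    using sum_shift_l[OF that, of \<nu> m]
    unfolding S_def h_def h'_def weight_upd_l[OF that] weight_upd_l'[OF that] by (simp add: mult_ac)
  have g: "(\<Sum>(l, k)\<in>int_box N m \<times> int_box N m. ccoef N (k(i := k i - 1)) \<nu> * weight N \<nu> m l l k) = S (g i)"
    if "i \<in> {1..N-1}" for i
  proof -
    have "i \<in> {1..N}" using that by auto
    from sum_shift_k[OF this, of \<nu> m] show ?thesis
      unfolding S_def g_def weight_upd_k[OF that] by (simp add: mult_ac)
  qed
  have gN: "(\<Sum>(l, k)\<in>int_box N m \<times> int_box N m. ccoef N (k(N := k N - 1)) \<nu> * weight N \<nu> m l l k) = S gN"
    using sum_shift_k[of N N \<nu> m] assms(1)
    unfolding S_def gN_def weight_upd_k_last[OF assms(1)] by (simp add: mult_ac)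
  \<comment> \<open>The recurrence for the rank N coefficients lowers \<open>k\<close> in the
    coefficient; \<open>g\<close> and \<open>gN\<close> then move the shift onto the weight.\<close>
  have "S (\<lambda>l k. qform N k \<nu>) =
      (\<Sum>(l, k)\<in>int_box N m \<times> int_box N m. ((\<Sum>i=1..N-1. ccoef N (k(i := k i - 1)) \<nu>)
        + 1/2 * ccoef N (k(N := k N - 1)) \<nu>) * weight N \<nu> m l l k)"
    unfolding S_def
  proof (intro sum.cong refl, clarify)
    fix l k assume "k \<in> int_box N m"
    then have "\<forall>i\<in>{1..N}. 0 \<le> k i" by (simp add: int_box_def)
    from ccoef_recurrence[OF assms this]
    show "qform N k \<nu> * (ccoef N k \<nu> * weight N \<nu> m l l k) =
        ((\<Sum>i=1..N-1. ccoef N (k(i := k i - 1)) \<nu>) + 1/2 * ccoef N (k(N := k N - 1)) \<nu>)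
          * weight N \<nu> m l l k"
      by (simp only: mult.assoc[symmetric])
  qed
  also have "\<dots> = (\<Sum>i=1..N-1. S (g i)) + 1/2 * S gN"
  proof -
    have "(\<Sum>i=1..N-1. S (g i)) = (\<Sum>(l, k)\<in>int_box N m \<times> int_box N m.
        \<Sum>i=1..N-1. ccoef N (k(i := k i - 1)) \<nu> * weight N \<nu> m l l k)"
      unfolding case_prod_unfold
      by (subst sum.swap) (rule sum.cong[OF refl], simp add: g[symmetric] case_prod_unfold)
    then show ?thesis
      unfolding gN[symmetric]
      by (simp add: case_prod_unfold sum.distrib sum_distrib_left sum_distrib_right distrib_right mult.assoc)
  qed
  finally have q: "S (\<lambda>l k. qform N k \<nu>) = (\<Sum>i=1..N-1. S (g i)) + 1/2 * S gN" .
  \<comment> \<open>\<open>qform_identity\<close> summed against the common summand. The right-hand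
    side vanishes by \<open>q\<close> and by the summation by parts \<open>h\<close>.\<close>
  have "S (\<lambda>l k. qform (Suc N) m \<nu> - (\<Sum>i=1..N. f i l k) - 1/2 * fN l k) =
      S (\<lambda>l k. qform N k \<nu> - (\<Sum>i=1..N-1. g i l k) - 1/2 * gN l k
        + (\<Sum>i=1..N. h' i l k) - (\<Sum>i=1..N. h i l k))"
    unfolding f_def fN_def g_def gN_def h_def h'_def
    by (intro S_cong qform_identity assms(1)) (auto simp: int_box_def supp_on_def)
  also have "\<dots> = 0"
    using h by (simp add: S_add S_diff S_half S_sum q del: of_int_diff)
  finally have "S (\<lambda>l k. qform (Suc N) m \<nu>) - (\<Sum>i=1..N. S (f i)) - 1/2 * S fN = 0"
    by (simp add: S_diff S_half S_sum)
  then have "S (\<lambda>l k. qform (Suc N) m \<nu>) = (\<Sum>i=1..N. S (f i)) + 1/2 * S fN"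
    by (simp only: diff_diff_eq right_minus_eq)
  moreover have "S (\<lambda>l k. qform (Suc N) m \<nu>) = qform (Suc N) m \<nu> * rec_sum N \<nu> m"
    by (simp add: S_def rec_sum_def case_prod_unfold sum_distrib_left)
  ultimately show ?thesis using f by (simp add: fN)
qed

text \<open>A negative entry at an index up to N empties the box; a negative last entry makes 1/(m_n
  - k_N)! vanish since k_N \<ge> 0.\<close>

lemma rec_sum_neg:
  assumes "N \<ge> 1" "\<exists>i\<in>{1..Suc N}. m i < 0"
  shows "rec_sum N \<nu> m = 0"
  unfolding rec_sum_def
proof (intro sum.neutral ballI)
  fix x assume x: "x \<in> int_box N m \<times> int_box N m"
  obtain l k where lk: "x = (l, k)" by (cases x)
  from x lk have le: "\<forall>i\<in>{1..N}. 0 \<le> l i \<and> l i \<le> m i" "0 \<le> k N"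
    using assms(1) by (auto simp: int_box_def)
  obtain i where i: "i \<in> {1..Suc N}" "m i < 0" using assms(2) by blast
  have "i = Suc N"
  proof (rule ccontr)
    assume "i \<noteq> Suc N"
    with i(1) have "i \<in> {1..N}" by simp
    with le(1) have "0 \<le> m i" by (blast intro: order_trans)
    with i(2) show False by simp
  qed
  with i le have "rpoch 1 (m (Suc N) - k N) = 0" by (intro rpoch_1_neg) simp
  then show "(case x of (l, k) \<Rightarrow> ccoef N k \<nu> * weight N \<nu> m l l k) = 0"
    by (simp add: lk weight_def)
qed

text \<open>The box shrinks to the zero vector. Its one weight is a product of values
  \<open>rpoch a 0\<close>, each 1 as no parameter is a pole of Gamma.\<close>

lemma rec_sum_zero:
  assumes "\<forall>i\<in>{1..Suc N}. m i = 0"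
    and "\<And>i. i \<in> {1..Suc N} \<Longrightarrow> \<nu> i + \<nu> (Suc N) + 1 \<notin> \<int>\<^sub>\<le>\<^sub>0"
    and "\<And>i. i \<in> {1..N} \<Longrightarrow> \<nu> i - \<nu> (Suc N) + 1 \<notin> \<int>\<^sub>\<le>\<^sub>0"
  shows "rec_sum N \<nu> m = 1"
proof -
  have "int_box N m = {\<lambda>_. 0}"
  proof (intro equalityI subsetI)
    fix f assume f: "f \<in> int_box N m"
    have "f i = 0" for i
    proof (cases "i \<in> {1..N}")
      case True
      then have "m i = 0" using assms(1) by simp
      then show ?thesis using f True unfolding int_box_def by force
    qed (use f in \<open>auto simp: int_box_def supp_on_def\<close>)
    then show "f \<in> {\<lambda>_. 0}" by auto
  qed (use assms(1) in \<open>auto simp: int_box_def supp_on_def\<close>)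
  moreover have "rpoch 1 0 = 1" using rpoch_1_nat[of 0] by simp
  then have "weight N \<nu> m (\<lambda>_. 0) (\<lambda>_. 0) (\<lambda>_. 0) = 1"
    unfolding weight_def diag_kernel_def offdiag_kernel_def
    using assms by (simp add: rpoch_0)
  ultimately show ?thesis by (simp add: rec_sum_def ccoef_zero)
qed

section \<open>Consequences of regularity\<close>

lemma in_root_lattice_Ints:
  assumes "\<And>j. j \<in> {1..n} \<Longrightarrow> v j \<in> \<int>"
  shows "in_root_lattice n v"
proof -
  define z where "z j = \<lfloor>Re (v j)\<rfloor>" for j
  have z: "v j = of_int (z j)" if "j \<in> {1..n}" for j
    using assms[OF that] by (auto elim!: Ints_cases simp: z_def)
  \<comment> \<open>The j-th entry of the combination is (a_j - a_(j-1))/2 with a_0 = 0; doubled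
    partial sums solve this.\<close>
  define a where "a i = 2 * (\<Sum>t=1..i. z t)" for i
  have "v j = (\<Sum>i=1..n. of_int (a i) * simple_root n i j)" if j: "j \<in> {1..n}" for j
  proof -
    have root: "simple_root n i j = 1/2 * ((if i = j then 1 else 0) - (if i = j - 1 then 1 else 0))"
      if "i \<in> {1..n}" for i
      using that j by (auto simp: simple_root_def unit_vec_def)
    have "(\<Sum>i=1..n. of_int (a i) * simple_root n i j) =
        (\<Sum>i=1..n. 1/2 * (if i = j then of_int (a i) else 0) - 1/2 * (if i = j - 1 then of_int (a i) else 0))"
      by (intro sum.cong refl) (simp add: root)
    also have "\<dots> = 1/2 * of_int (a j) - 1/2 * (if j - 1 \<in> {1..n} then of_int (a (j - 1)) else 0)"
      using j by (simp add: sum_subtractf sum.delta flip: sum_divide_distrib)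
    also have "\<dots> = of_int (z j)"
    proof (cases "j = 1")
      case False
      then obtain i where "j = Suc i" "i \<in> {1..n}" using j by (cases j) auto
      then show ?thesis by (simp add: a_def add_divide_distrib)
    qed (simp add: a_def)
    finally show ?thesis using z[OF j] by simp
  qed
  then show ?thesis unfolding in_root_lattice_def by blast
qed

text \<open>Otherwise \<nu> and its image differ by an integer vector, which lies in the lattice,
  against regularity. The pair \<open>v\<close>, \<open>j\<close> witnesses that the signed
  permutation is not the identity map.\<close>

lemma regular_signed_perm:
  assumes "regular n \<nu>" "p permutes {1..n}"
    and "\<And>i. s i \<in> {1, -1}" "\<And>i. i \<notin> {1..n} \<Longrightarrow> s i = 1"
    and "s j * v (p j) \<noteq> (v j :: complex)"
  shows "\<exists>i\<in>{1..n}. \<nu> i - s i * \<nu> (p i) \<notin> \<int>"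
proof (rule ccontr)
  assume "\<not> ?thesis"
  then have "in_root_lattice n (\<lambda>i. \<nu> i - s i * \<nu> (p i))"
    by (intro in_root_lattice_Ints) blast
  moreover have "(\<lambda>\<nu> i. s i * \<nu> (p i)) \<in> weyl_group n"
    unfolding weyl_group_def using assms(2-4) by (intro CollectI exI[of _ s] exI[of _ p]) simp
  moreover have "(\<lambda>\<nu>. \<nu>) \<in> weyl_group n"
    unfolding weyl_group_def
    by (rule CollectI, rule exI[of _ "\<lambda>_. 1"], rule exI[of _ id]) (simp add: permutes_id)
  moreover have "(\<lambda>\<nu>. \<nu>) \<noteq> (\<lambda>\<nu> i. s i * \<nu> (p i))"
  proof
    assume "(\<lambda>\<nu>. \<nu>) = (\<lambda>\<nu> i. s i * \<nu> (p i))"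
    from fun_cong[OF fun_cong[OF this, of v], of j] assms(5) show False by simp
  qed
  ultimately show False
    using assms(1)[unfolded regular_def, THEN conjunct2, rule_format] by blast
qed

text \<open>The sign change of the last coordinate alters only entry n of \<nu>, by 2
  \<nu>_n.\<close>

lemma regular_2_notin_Ints:
  assumes "regular n \<nu>" "n \<ge> 1"
  shows "2 * \<nu> n \<notin> \<int>"
proof -
  have "\<exists>i\<in>{1..n}. \<nu> i - (if i = n then -1 else 1) * \<nu> (id i) \<notin> \<int>"
    by (rule regular_signed_perm[OF assms(1) permutes_id, where j = n and v = "\<lambda>_. 1"])
      (use assms(2) in auto)
  then show ?thesis by (auto split: if_splits)
qed

text \<open>Swapping entries i and n changes them by the difference of the two, up to sign; swapping
  with both signs reversed changes each by their sum.\<close>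

lemma regular_add_diff_notin_Ints:
  assumes "regular n \<nu>" "1 \<le> i" "i < n"
  shows "\<nu> i - \<nu> n \<notin> \<int>" "\<nu> i + \<nu> n \<notin> \<int>"
proof -
  have perm: "Transposition.transpose i n permutes {1..n}" using assms by (intro permutes_swap_id) auto
  have "\<exists>j\<in>{1..n}. \<nu> j - 1 * \<nu> (Transposition.transpose i n j) \<notin> \<int>"
    by (rule regular_signed_perm[OF assms(1) perm, where j = i and v = "unit_vec i"])
      (use assms(3) in \<open>auto simp: unit_vec_def\<close>)
  then show "\<nu> i - \<nu> n \<notin> \<int>"
    using minus_in_Ints_iff[of "\<nu> i - \<nu> n"]
    by (auto simp: Transposition.transpose_def split: if_splits)
  have "\<exists>j\<in>{1..n}. \<nu> j - (if j = i \<or> j = n then -1 else 1) * \<nu> (Transposition.transpose i n j) \<notin> \<int>"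
    by (rule regular_signed_perm[OF assms(1) perm, where j = i and v = "unit_vec i"])
      (use assms(2,3) in \<open>auto simp: unit_vec_def\<close>)
  then show "\<nu> i + \<nu> n \<notin> \<int>"
    by (auto simp: Transposition.transpose_def add.commute split: if_splits)
qed

lemma plus_1_notin_nonpos_Ints: "a \<notin> \<int> \<Longrightarrow> a + 1 \<notin> \<int>\<^sub>\<le>\<^sub>0" for a :: complex
  using nonpos_Ints_Int[of "a + 1"] Ints_diff[of "a + 1" 1] by auto

section \<open>Identification of the coefficients\<close>

lemma ccoef_eq_rec_sum:
  assumes "N \<ge> 1" "regular (Suc N) \<nu>"
  shows "ccoef (Suc N) m \<nu> = rec_sum N \<nu> m"
proof (rule ccoef_unique[symmetric])
  show "nondegenerate (Suc N) \<nu>" using regular_imp_nondegenerate[OF assms(2), of "Suc N"] by simp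
  show "rec_sum N \<nu> m = 0" if "\<exists>i\<in>{1..Suc N}. m i < 0" for m
    using rec_sum_neg[OF assms(1) that] .
  show "rec_sum N \<nu> m = 1" if "\<forall>i\<in>{1..Suc N}. m i = 0" for m
  proof (rule rec_sum_zero[OF that])
    \<comment> \<open>The index i = Suc N gives twice the last entry and is settled by the sign
      change.\<close>
    show "\<nu> i + \<nu> (Suc N) + 1 \<notin> \<int>\<^sub>\<le>\<^sub>0" if "i \<in> {1..Suc N}" for i
      using that regular_2_notin_Ints[OF assms(2)] regular_add_diff_notin_Ints(2)[OF assms(2), of i]
      by (intro plus_1_notin_nonpos_Ints) (cases "i = Suc N"; auto)
    show "\<nu> i - \<nu> (Suc N) + 1 \<notin> \<int>\<^sub>\<le>\<^sub>0" if "i \<in> {1..N}" for i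
      using that regular_add_diff_notin_Ints(1)[OF assms(2), of i]
      by (intro plus_1_notin_nonpos_Ints) auto
  qed
  show "qform (Suc N) m \<nu> * rec_sum N \<nu> m =
      (\<Sum>i=1..Suc N - 1. rec_sum N \<nu> (m(i := m i - 1))) + 1/2 * rec_sum N \<nu> (m(Suc N := m (Suc N) - 1))"
    for m
    using rec_sum_recurrence[OF assms(1) regular_imp_nondegenerate[OF assms(2)]] assms(1) by simp
qed

text \<open>Surplus pairs of the box violate k \<le> l or k_N \<le> m_n, and there a reciprocal
  factorial vanishes.\<close>

lemma rec_sum_eq_sum_range:
  assumes "N \<ge> 1"
  shows "rec_sum N \<nu> (\<lambda>i. int (m i)) =
    (\<Sum>(l, k)\<in>sum_range (Suc N) m. ccoef N (\<lambda>i. int (k i)) \<nu> *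
      weight N \<nu> (\<lambda>i. int (m i)) (\<lambda>i. int (l i)) (\<lambda>i. int (l i)) (\<lambda>i. int (k i)))"
proof -
  define h where "h = (map_prod (\<lambda>l i. int (l i)) (\<lambda>k i. int (k i)) :: (nat \<Rightarrow> nat) \<times> (nat \<Rightarrow> nat) \<Rightarrow> _)"
  define F where "F = (\<lambda>(l, k). ccoef N k \<nu> * weight N \<nu> (\<lambda>i. int (m i)) l l k)"
  let ?B = "int_box N (\<lambda>i. int (m i))"
  have inj: "inj_on h (sum_range (Suc N) m)"
    by (auto simp: inj_on_def h_def fun_eq_iff)
  have "rec_sum N \<nu> (\<lambda>i. int (m i)) = sum F (?B \<times> ?B)"
    by (simp add: rec_sum_def F_def)
  also have "\<dots> = sum F (h ` sum_range (Suc N) m)"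
  proof (rule sum.mono_neutral_right)
    show "finite (?B \<times> ?B)" by (simp add: finite_int_box)
    show "h ` sum_range (Suc N) m \<subseteq> ?B \<times> ?B"
    proof
      fix x assume "x \<in> h ` sum_range (Suc N) m"
      then obtain l k where x: "x = (\<lambda>i. int (l i), \<lambda>i. int (k i))" and lk: "(l, k) \<in> sum_range (Suc N) m"
        by (auto simp: h_def)
      from lk have le: "k i \<le> l i" "l i \<le> m i" if "i \<in> {1..N}" for i
        using that by (auto simp: sum_range_def)
      then have "k i \<le> m i" if "i \<in> {1..N}" for i using that by (blast intro: order_trans)
      with le lk show "x \<in> ?B \<times> ?B"
        by (auto simp: x sum_range_def int_box_def supp_on_def)
    qed
    show "\<forall>x\<in>?B \<times> ?B - h ` sum_range (Suc N) m. F x = 0"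
    proof (rule ballI, rule ccontr)
      fix x assume x: "x \<in> ?B \<times> ?B - h ` sum_range (Suc N) m" and nz: "F x \<noteq> 0"
      obtain l k where lk: "x = (l, k)" by (cases x)
      from x lk have B: "l \<in> ?B" "k \<in> ?B" by auto
      have nn: "0 \<le> l i" "0 \<le> k i" for i
        using B by (cases "i \<in> {1..N}"; simp add: int_box_def supp_on_def)+
      have "k i \<le> l i" if "i \<in> {1..N}" for i
        using nz weight_eq_0[OF that, of "\<lambda>i. int (m i)" l l k \<nu>]
        by (cases "l i < k i") (simp_all add: F_def lk)
      moreover have "k N \<le> int (m (Suc N))"
        using nz rpoch_1_neg[of "int (m (Suc N)) - k N"]
        by (cases "int (m (Suc N)) < k N") (simp_all add: F_def lk weight_def)
      ultimately have "(\<lambda>i. nat (l i), \<lambda>i. nat (k i)) \<in> sum_range (Suc N) m"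
        using B by (auto simp: sum_range_def int_box_def supp_on_def nat_le_iff)
      moreover have "x = h (\<lambda>i. nat (l i), \<lambda>i. nat (k i))"
        using nn by (simp add: lk h_def)
      ultimately show False using x by blast
    qed
  qed
  also have "\<dots> = sum (F \<circ> h) (sum_range (Suc N) m)" by (rule sum.reindex[OF inj])
  finally show ?thesis by (simp add: F_def h_def case_prod_unfold o_def)
qed

text \<open>In rank one, lowering x multiplies the product of the two reciprocal symbols by x (x + 2
  \<nu>_1), which is twice the quadratic form; uniqueness concludes.\<close>

lemma ccoef_1:
  assumes "nondegenerate 1 \<nu>"
  shows "ccoef 1 (\<lambda>_. int m) \<nu> = 1 / (fact m * poch (2 * \<nu> 1 + 1) (int m))"
proof -
  \<comment> \<open>The quadratic form at j + 1 has this factor, so nondegeneracy keeps 2 \<nu>_1 +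
    1 off the poles of Gamma.\<close>
  have nz: "2 * \<nu> 1 + of_nat (Suc j) \<noteq> 0" for j
  proof -
    have "qform 1 (\<lambda>_. int (Suc j)) \<nu> \<noteq> 0"
      using assms[unfolded nondegenerate_def, rule_format, of "\<lambda>_. Suc j"] by simp
    moreover have "qform 1 (\<lambda>_. int (Suc j)) \<nu> = 1/2 * of_nat (Suc j) * (2 * \<nu> 1 + of_nat (Suc j))"
      by (simp add: qform_def power2_eq_square field_simps)
    ultimately show ?thesis by auto
  qed
  have nonpos: "2 * \<nu> 1 + 1 \<notin> \<int>\<^sub>\<le>\<^sub>0"
  proof
    assume "2 * \<nu> 1 + 1 \<in> \<int>\<^sub>\<le>\<^sub>0"
    then obtain j where "2 * \<nu> 1 + 1 = - of_nat j" by (elim nonpos_Ints_cases')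
    then have "(2 * \<nu> 1 + 1) + of_nat j = 0" by simp
    with nz[of j] show False by (simp add: add.assoc)
  qed
  have "rpoch 1 (x 1) * rpoch (2 * \<nu> 1 + 1) (x 1) = ccoef 1 x \<nu>" for x
  proof (rule ccoef_unique[OF assms])
    fix x :: "nat \<Rightarrow> int"
    show "rpoch 1 (x 1) * rpoch (2 * \<nu> 1 + 1) (x 1) = 0" if "\<exists>i\<in>{1..1}. x i < 0"
      using that by (simp add: rpoch_1_neg)
    show "rpoch 1 (x 1) * rpoch (2 * \<nu> 1 + 1) (x 1) = 1" if "\<forall>i\<in>{1..1}. x i = 0"
      using that rpoch_1_nat[of 0] rpoch_0[OF nonpos] by simp
    show "qform 1 x \<nu> * (rpoch 1 (x 1) * rpoch (2 * \<nu> 1 + 1) (x 1)) =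
      (\<Sum>i=1..1-1. rpoch 1 ((x(i := x i - 1)) 1) * rpoch (2 * \<nu> 1 + 1) ((x(i := x i - 1)) 1)) +
      1/2 * (rpoch 1 ((x(1 := x 1 - 1)) 1) * rpoch (2 * \<nu> 1 + 1) ((x(1 := x 1 - 1)) 1))"
      by (simp add: rpoch_pred qform_def power2_eq_square algebra_simps)
  qed
  from this[of "\<lambda>_. int m"] show ?thesis
    using inverse_poch[of "2 * \<nu> 1 + 1" "int m", symmetric] by (simp add: rpoch_1_nat mult.commute)
qed

theorem theorem2p1:
  fixes n :: nat and \<nu> :: "nat \<Rightarrow> complex"
  assumes "n \<ge> 2" and "regular n \<nu>"
  shows "(\<forall>\<nu>\<^sub>1 :: complex. nondegenerate 1 (\<lambda>_. \<nu>\<^sub>1) \<longrightarrow>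
           (\<forall>m\<^sub>1 :: nat. ccoef 1 (\<lambda>_. int m\<^sub>1) (\<lambda>_. \<nu>\<^sub>1) = 1 / (fact m\<^sub>1 * poch (2 * \<nu>\<^sub>1 + 1) (int m\<^sub>1))))
    \<and> (\<forall>m\<^sub>1 :: nat. ccoef 1 (\<lambda>_. int m\<^sub>1) \<nu> = 1 / (fact m\<^sub>1 * poch (2 * \<nu> 1 + 1) (int m\<^sub>1)))
    \<and> (\<forall>m :: nat \<Rightarrow> nat.
         ccoef n (\<lambda>i. int (m i)) \<nu> =
         (\<Sum>(l, k)\<in>sum_range n m.
            ccoef (n - 1) (\<lambda>i. int (k i)) (restrict \<nu> {1..n-1})
              / ((\<Prod>i=1..n-1. fact (m i - l i)) * fact (m n - k (n-1)) * (\<Prod>i=1..n-1. fact (l i - k i)))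
            * (1 / ((\<Prod>i=1..n. poch (\<nu> i + \<nu> n + 1) (int (m i) - int (l (i-1))))
                    * (\<Prod>i=1..n-1. poch (\<nu> i - \<nu> n + 1) (int (l i) - int (k (i-1))))))))"
proof (intro conjI allI impI)
  show "ccoef 1 (\<lambda>_. int m\<^sub>1) (\<lambda>_. \<nu>\<^sub>1) = 1 / (fact m\<^sub>1 * poch (2 * \<nu>\<^sub>1 + 1) (int m\<^sub>1))"
    if "nondegenerate 1 (\<lambda>_. \<nu>\<^sub>1)" for \<nu>\<^sub>1 m\<^sub>1
    using ccoef_1[OF that] .
  show "ccoef 1 (\<lambda>_. int m\<^sub>1) \<nu> = 1 / (fact m\<^sub>1 * poch (2 * \<nu> 1 + 1) (int m\<^sub>1))" for m\<^sub>1
    using ccoef_1 regular_imp_nondegenerate[OF assms(2), of 1] assms(1) by simp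
next
  fix m :: "nat \<Rightarrow> nat"
  obtain N where n: "n = Suc N" "N \<ge> 1" using assms(1) by (cases n) auto
  have restr: "ccoef N k (restrict \<nu> {1..N}) = ccoef N k \<nu>" for k
    by (rule ccoef_cong) auto
  have *: "ccoef N (\<lambda>i. int (k i)) \<nu> *
        weight N \<nu> (\<lambda>i. int (m i)) (\<lambda>i. int (l i)) (\<lambda>i. int (l i)) (\<lambda>i. int (k i)) =
      ccoef N (\<lambda>i. int (k i)) (restrict \<nu> {1..N})
        / ((\<Prod>i=1..N. fact (m i - l i)) * fact (m (Suc N) - k N) * (\<Prod>i=1..N. fact (l i - k i)))
      * (1 / ((\<Prod>i=1..Suc N. poch (\<nu> i + \<nu> (Suc N) + 1) (int (m i) - int (l (i-1))))
              * (\<Prod>i=1..N. poch (\<nu> i - \<nu> (Suc N) + 1) (int (l i) - int (k (i-1))))))"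
    if "(l, k) \<in> sum_range (Suc N) m" for l k
  proof -
    from that have le: "\<And>i. i \<in> {1..N} \<Longrightarrow> k i \<le> l i" "\<And>i. i \<in> {1..N} \<Longrightarrow> l i \<le> m i" "k N \<le> m (Suc N)"
      by (auto simp: sum_range_def)
    have diag: "diag_kernel N (\<lambda>i. int (x i)) (\<lambda>i. int (y i)) = 1 / (\<Prod>i=1..N. fact (x i - y i))"
      if "\<And>i. i \<in> {1..N} \<Longrightarrow> y i \<le> x i" for x y :: "nat \<Rightarrow> nat"
      unfolding diag_kernel_def using that by (simp add: rpoch_1_diff prod_dividef)
    \<comment> \<open>The indices here can be negative, which \<open>inverse_poch\<close>
      allows.\<close>
    have offdiag: "offdiag_kernel n a x y = 1 / (\<Prod>i=1..n. poch (a i) (x i - y (i-1)))" for n a x y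
      unfolding offdiag_kernel_def by (simp add: prod_dividef flip: inverse_poch)
    have "diag_kernel N (\<lambda>i. int (l i)) (\<lambda>i. int (k i)) = 1 / (\<Prod>i=1..N. fact (l i - k i))"
      and "diag_kernel N (\<lambda>i. int (m i)) (\<lambda>i. int (l i)) = 1 / (\<Prod>i=1..N. fact (m i - l i))"
      using le by (blast intro: diag)+
    then show ?thesis
      unfolding restr weight_def offdiag rpoch_1_diff[OF le(3)]
      by (simp only: times_divide_times_eq times_divide_eq_left times_divide_eq_right
          mult_1_left mult_1_right divide_divide_eq_left mult_ac)
  qed
  show "ccoef n (\<lambda>i. int (m i)) \<nu> =
         (\<Sum>(l, k)\<in>sum_range n m.
            ccoef (n - 1) (\<lambda>i. int (k i)) (restrict \<nu> {1..n-1})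
              / ((\<Prod>i=1..n-1. fact (m i - l i)) * fact (m n - k (n-1)) * (\<Prod>i=1..n-1. fact (l i - k i)))
            * (1 / ((\<Prod>i=1..n. poch (\<nu> i + \<nu> n + 1) (int (m i) - int (l (i-1))))
                    * (\<Prod>i=1..n-1. poch (\<nu> i - \<nu> n + 1) (int (l i) - int (k (i-1)))))))"
    unfolding n(1) diff_Suc_1
      ccoef_eq_rec_sum[OF n(2) assms(2)[unfolded n(1)]] rec_sum_eq_sum_range[OF n(2)]
    by (intro sum.cong refl) (use * in auto)
qed

end
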